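(* Let $d\in\mathbb{N}$, let $X=(V,E)$ be a $d$-dimensional crystal lattice with covering transformation group $\Gamma=\mathbb{Z}^d$ whose quotient graph has exactly one vertex, and let $\Phi:X\to\Gamma\otimes\mathbb{R}\cong\mathbb{R}^d$ be a non-degenerate periodic realization with $\Phi(x_* )=\mathbf{0}$ for a base point $x_*\in V$. Let $m\in\mathbb{N}$, $-1\le\alpha_\ell\le1$ and $\vec a_\ell\in\mathcal{J}$ for $\ell=1,\dots,m$, and $$Z_{fE}^{X,\Phi}(\vec s)=\prod_{\ell=1}^m\big(1-\alpha_\ell e^{-\langle\vec a_\ell,\vec s\rangle}\big)^{-1}.$$ Suppose that $\vec a_1,\dots,\vec a_m$ are linearly independent (over $\mathbb{R}$) and that $\vec\sigma\in\mathbb{R}^d$ satisfies $\min\{\langle\vec a_\ell,\vec\sigma\rangle\mid\ell=1,\dots,m\}>0$. Then the function $$f_{\vec\sigma}^{X,\Phi}(\vec t)=\frac{Z_{fE}^{X,\Phi}(\vec\sigma+\mathrm{i}\vec t)}{Z_{fE}^{X,\Phi}(\vec\sigma)},\qquad\vec t\in\mathbb{R}^d,$$ is a characteristic function (of a probability measure on $\mathbb{R}^d$) if and only if $\alpha_\ell\ge0$ for all $\ell=1,\dots,m$. Moreover, in this case $f_{\vec\sigma}^{X,\Phi}$ is a compound Poisson characteristic function with finite Lévy measure $$N_{\vec\sigma}^{X,\Phi}(d\vec x)=\sum_{r=1}^\infty\sum_{\ell=1}^m\frac1r\,\alpha_\ell^r\,e^{-r\langle\vec a_\ell,\vec\sigma\rangle}\,\delta_{r\vec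 a_\ell}(d\vec x),$$ in the sense that $N_{\vec\sigma}^{X,\Phi}$ is a finite measure on $\mathbb{R}^d$ with $N_{\vec\sigma}^{X,\Phi}(\{\mathbf{0}\})=0$ and $$f_{\vec\sigma}^{X,\Phi}(\vec t)=\exp\Big(\int_{\mathbb{R}^d}\big(e^{-\mathrm{i}\langle\vec t,\vec x\rangle}-1\big)\,N_{\vec\sigma}^{X,\Phi}(d\vec x)\Big),\qquad\vec t\in\mathbb{R}^d.$$
   Context: Crystal lattice. $X=(V,E)$ is a connected, locally finite infinite graph (loops and multiple edges allowed) which is a regular covering graph of a finite graph $X_0=(V_0,E_0)$ with covering transformation group $\Gamma=\mathbb{Z}^d$ acting freely on $X$ and transitively on fibers, $X_0\cong\Gamma\backslash X$; here $|V_0|=1$. A periodic realization is a piecewise linear map $\Phi:X\to\Gamma\otimes\mathbb{R}\cong\mathbb{R}^d$ with $\Phi(\gamma y)=\Phi(y)+\gamma$ for $\gamma\in\Gamma$, $y\in V$ ($\gamma$ identified with $\gamma\otimes1$); it is non-degenerate if it is injective on $V$, $\Phi(t(e))-\Phi(o(e))\ne\mathbf{0}$ for every oriented edge $e$ (with origin $o(e)$ and terminus $t(e)$), and distinct edges with the same origin have distinct directions in $\mathbb{R}^d$. Jump set. Let $\mathcal{S}=\{\gamma_1,\dots,\gamma_d\}$ be a set of generators of $\Gamma$, each $\gamma_i$ identified with the vector $\gamma_i\otimes1\in\mathbb{R}^d$. Then $$\mathcal{J}=\{\varepsilon_1\gamma_{i_1}+\cdots+\varepsilon_k\gamma_{i_k}\mid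 k\in\mathbb{N},\ \gamma_{i_j}\in\mathcal{S},\ \varepsilon_j=\pm1\},$$ that is, $\mathcal{J}$ is the lattice $\Gamma\subset\mathbb{R}^d$ (equal to $\Phi(V)$). Notation. For $\vec c\in\mathbb{R}^d$ and $\vec s=\vec\sigma+\mathrm{i}\vec t\in\mathbb{C}^d$, $\langle\vec c,\vec s\rangle=\langle\vec c,\vec\sigma\rangle+\mathrm{i}\langle\vec c,\vec t\rangle$. The characteristic function of a probability measure $\mu$ on $\mathbb{R}^d$ is $\widehat\mu(\vec t)=\int e^{\mathrm{i}\langle\vec t,\vec x\rangle}\mu(d\vec x)$. The degenerate case $N_{\vec\sigma}^{X,\Phi}=0$ (all $\alpha_\ell=0$, $f\equiv1$) is admitted as compound Poisson. *)

theory Defs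
  imports
    "HOL-Probability.Probability"
    "HOL-Computational_Algebra.Group_Closure"
    "Graph_Theory.Bidirected_Digraph"
    "Graph_Theory.Digraph_Component"
begin

section \<open>Crystal lattices\<close>

text \<open>
  A graph, possibly with loops and multiple edges, is given by its oriented edges: a digraph
  together with a fixed-point-free involution that reverses every edge
  (\<^locale>\<open>bidirected_digraph\<close>). Each unoriented edge, loops included, is thus a pair of arcs.
\<close>

definition graph_covering ::
    "('v, 'e) pre_digraph \<Rightarrow> ('e \<Rightarrow> 'e) \<Rightarrow> ('w, 'f) pre_digraph \<Rightarrow> ('f \<Rightarrow> 'f) \<Rightarrow>
     ('v \<Rightarrow> 'w) \<Rightarrow> ('e \<Rightarrow> 'f) \<Rightarrow> bool" where
  "graph_covering X arev X0 arev0 pV pE \<longleftrightarrow>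
     pV ` verts X = verts X0 \<and> pE ` arcs X = arcs X0 \<and>
     (\<forall>e\<in>arcs X. tail X0 (pE e) = pV (tail X e) \<and> head X0 (pE e) = pV (head X e)
        \<and> pE (arev e) = arev0 (pE e)) \<and>
     (\<forall>v\<in>verts X. bij_betw pE (out_arcs X v) (out_arcs X0 (pV v)))"

definition graph_action ::
    "('v, 'e) pre_digraph \<Rightarrow> ('e \<Rightarrow> 'e) \<Rightarrow> ('g::group_add \<Rightarrow> 'v \<Rightarrow> 'v) \<Rightarrow> ('g \<Rightarrow> 'e \<Rightarrow> 'e) \<Rightarrow> bool" where
  "graph_action X arev actV actE \<longleftrightarrow>
     (\<forall>v\<in>verts X. actV 0 v = v \<and>
        (\<forall>g. actV g v \<in> verts X \<and> (\<forall>h. actV (g + h) v = actV g (actV h v)))) \<and>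
     (\<forall>e\<in>arcs X. actE 0 e = e \<and>
        (\<forall>g. actE g e \<in> arcs X \<and> (\<forall>h. actE (g + h) e = actE g (actE h e)))) \<and>
     (\<forall>e\<in>arcs X. \<forall>g. tail X (actE g e) = actV g (tail X e) \<and> head X (actE g e) = actV g (head X e)
        \<and> actE g (arev e) = arev (actE g e))"

definition free_graph_action ::
    "('v, 'e) pre_digraph \<Rightarrow> ('e \<Rightarrow> 'e) \<Rightarrow> ('g::group_add \<Rightarrow> 'v \<Rightarrow> 'v) \<Rightarrow> ('g \<Rightarrow> 'e \<Rightarrow> 'e) \<Rightarrow> bool" where
  "free_graph_action X arev actV actE \<longleftrightarrow>
     (\<forall>g. g \<noteq> 0 \<longrightarrow> (\<forall>v\<in>verts X. actV g v \<noteq> v) \<and>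
        (\<forall>e\<in>arcs X. actE g e \<noteq> e \<and> actE g e \<noteq> arev e))"

text \<open>
  The group \<open>\<Gamma>\<close> is \<^typ>\<open>int ^ 'd\<close>. The assumptions \<open>fiber_vert\<close> and \<open>fiber_arc\<close> say that the
  fibers of the covering are exactly the \<open>\<Gamma>\<close>-orbits: \<open>\<Gamma>\<close> acts by covering transformations,
  transitively on fibers, and \<open>X0\<close> is the quotient of \<open>X\<close> by \<open>\<Gamma>\<close>. As \<open>X\<close> is connected, \<open>\<Gamma>\<close> is
  then the full covering transformation group.
\<close>

locale crystal_lattice =
  X: bidirected_digraph X arev + X0: bidirected_digraph X0 arev0 + X0: fin_digraph X0
  for X :: "('v, 'e) pre_digraph" and arev :: "'e \<Rightarrow> 'e"
    and X0 :: "('w, 'f) pre_digraph" and arev0 :: "'f \<Rightarrow> 'f" +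
  fixes pV :: "'v \<Rightarrow> 'w" and pE :: "'e \<Rightarrow> 'f"
    and actV :: "int ^ 'd \<Rightarrow> 'v \<Rightarrow> 'v" and actE :: "int ^ 'd \<Rightarrow> 'e \<Rightarrow> 'e"
  assumes connected: "Digraph_Component.connected X"
    and infinite: "infinite (verts X)"
    and locally_finite: "v \<in> verts X \<Longrightarrow> finite (out_arcs X v)"
    and covering: "graph_covering X arev X0 arev0 pV pE"
    and action: "graph_action X arev actV actE"
    and free: "free_graph_action X arev actV actE"
    and fiber_vert: "\<lbrakk>v \<in> verts X; v' \<in> verts X\<rbrakk> \<Longrightarrow> pV v = pV v' \<longleftrightarrow> (\<exists>g. v' = actV g v)"
    and fiber_arc: "\<lbrakk>e \<in> arcs X; e' \<in> arcs X\<rbrakk> \<Longrightarrow> pE e = pE e' \<longleftrightarrow> (\<exists>g. e' = actE g e)"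


section \<open>Periodic realizations and the jump set\<close>

text \<open>
  \<open>\<Gamma> \<otimes> \<real>\<close> is \<^typ>\<open>real ^ 'd\<close> with \<open>\<gamma> \<otimes> 1\<close> the vector of real coordinates of \<open>\<gamma>\<close>; the
  identification \<open>\<iota>\<close> of \<open>\<Gamma> \<otimes> \<real>\<close> with Euclidean space may be any linear isomorphism.
\<close>

definition lattice_vec :: "(real ^ 'd \<Rightarrow> real ^ 'd) \<Rightarrow> int ^ 'd \<Rightarrow> real ^ 'd" where
  "lattice_vec \<iota> \<gamma> = \<iota> (\<chi> i. real_of_int (\<gamma> $ i))"

text \<open>
  A piecewise linear map is affine on every edge, hence determined by its values on the vertices;
  a realization is represented by these values.
\<close>

definition periodic_realization ::
    "(real ^ 'd \<Rightarrow> real ^ 'd) \<Rightarrow> ('v, 'e) pre_digraph \<Rightarrow> (int ^ 'd \<Rightarrow> 'v \<Rightarrow> 'v) \<Rightarrow>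
     ('v \<Rightarrow> real ^ 'd) \<Rightarrow> bool" where
  "periodic_realization \<iota> X actV \<Phi> \<longleftrightarrow>
     (\<forall>\<gamma>. \<forall>y\<in>verts X. \<Phi> (actV \<gamma> y) = \<Phi> y + lattice_vec \<iota> \<gamma>)"

definition edge_vec :: "('v, 'e) pre_digraph \<Rightarrow> ('v \<Rightarrow> real ^ 'd) \<Rightarrow> 'e \<Rightarrow> real ^ 'd" where
  "edge_vec X \<Phi> e = \<Phi> (head X e) - \<Phi> (tail X e)"

text \<open>The direction of a nonzero vector \<open>v\<close> is the unit vector \<open>sgn v = v / \<parallel>v\<parallel>\<close>.\<close>

definition nondegenerate :: "('v, 'e) pre_digraph \<Rightarrow> ('v \<Rightarrow> real ^ 'd) \<Rightarrow> bool" where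
  "nondegenerate X \<Phi> \<longleftrightarrow>
     inj_on \<Phi> (verts X) \<and>
     (\<forall>e\<in>arcs X. edge_vec X \<Phi> e \<noteq> 0) \<and>
     (\<forall>e\<in>arcs X. \<forall>e'\<in>arcs X. e \<noteq> e' \<and> tail X e = tail X e' \<longrightarrow>
        sgn (edge_vec X \<Phi> e) \<noteq> sgn (edge_vec X \<Phi> e'))"

definition jump_set :: "(real ^ 'd \<Rightarrow> real ^ 'd) \<Rightarrow> (int ^ 'd) set \<Rightarrow> (real ^ 'd) set" where
  "jump_set \<iota> S =
     {(\<Sum>j=1..k. \<epsilon> j *\<^sub>R lattice_vec \<iota> (g j)) | (k::nat) (\<epsilon> :: nat \<Rightarrow> real) g.
        k \<ge> 1 \<and> (\<forall>j\<in>{1..k}. (\<epsilon> j = 1 \<or> \<epsilon> j = -1) \<and> g j \<in> S)}"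


section \<open>The finite Euler product and its normalization\<close>

definition complex_vec :: "real ^ 'd \<Rightarrow> real ^ 'd \<Rightarrow> complex ^ 'd" where
  "complex_vec \<sigma> t = (\<chi> i. Complex (\<sigma> $ i) (t $ i))"

definition cinner :: "real ^ 'd \<Rightarrow> complex ^ 'd \<Rightarrow> complex" where
  "cinner c s = Complex (c \<bullet> (\<chi> i. Re (s $ i))) (c \<bullet> (\<chi> i. Im (s $ i)))"

definition Z_fE :: "nat \<Rightarrow> (nat \<Rightarrow> real) \<Rightarrow> (nat \<Rightarrow> real ^ 'd) \<Rightarrow> complex ^ 'd \<Rightarrow> complex" where
  "Z_fE m \<alpha> a s = (\<Prod>l=1..m. inverse (1 - complex_of_real (\<alpha> l) * exp (- cinner (a l) s)))"

definition f_norm :: "nat \<Rightarrow> (nat \<Rightarrow> real) \<Rightarrow> (nat \<Rightarrow> real ^ 'd) \<Rightarrow> real ^ 'd \<Rightarrow> real ^ 'd \<Rightarrow> complex" where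
  "f_norm m \<alpha> a \<sigma> t = Z_fE m \<alpha> a (complex_vec \<sigma> t) / Z_fE m \<alpha> a (complex_vec \<sigma> 0)"


section \<open>Characteristic functions and the Levy measure\<close>

definition is_char_fun :: "(real ^ 'd \<Rightarrow> complex) \<Rightarrow> bool" where
  "is_char_fun f \<longleftrightarrow>
     (\<exists>\<mu> :: (real ^ 'd) measure. prob_space \<mu> \<and> sets \<mu> = sets borel \<and>
        (\<forall>t. f t = (\<integral>x. exp (\<i> * complex_of_real (t \<bullet> x)) \<partial>\<mu>)))"

text \<open>
  Series index \<open>r\<close> stands for \<open>Suc r\<close>. For negative weights \<^const>\<open>ennreal\<close> truncates to \<open>0\<close>; the
  measure is only meant for nonnegative \<open>\<alpha>\<close>.
\<close>

definition levy_measure ::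
    "nat \<Rightarrow> (nat \<Rightarrow> real) \<Rightarrow> (nat \<Rightarrow> real ^ 'd) \<Rightarrow> real ^ 'd \<Rightarrow> (real ^ 'd) measure" where
  "levy_measure m \<alpha> a \<sigma> = measure_of UNIV (sets borel)
     (\<lambda>A. \<Sum>r. \<Sum>l=1..m.
        ennreal (1 / real (Suc r) * \<alpha> l ^ Suc r * exp (- (real (Suc r) * (a l \<bullet> \<sigma>))))
          * emeasure (return borel (real (Suc r) *\<^sub>R a l)) A)"

lemma sets_levy_measure [simp]: "sets (levy_measure m \<alpha> a \<sigma>) = sets borel"
  unfolding levy_measure_def using sets.sets_measure_of_eq[of borel] by (simp add: space_borel)

lemma emeasure_levy_measure:
  assumes "A \<in> sets borel"
  shows "emeasure (levy_measure m \<alpha> a \<sigma>) A = (\<Sum>r. \<Sum>l=1..m.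
    ennreal (1 / real (Suc r) * \<alpha> l ^ Suc r * exp (- (real (Suc r) * (a l \<bullet> \<sigma>))))
      * emeasure (return borel (real (Suc r) *\<^sub>R a l)) A)"
proof -
  define c where "c = (\<lambda>r l. ennreal (1 / real (Suc r) * \<alpha> l ^ Suc r *
    exp (- (real (Suc r) * (a l \<bullet> \<sigma>)))))"
  define M where "M = (\<lambda>r l. return borel (real (Suc r) *\<^sub>R a l))"
  define \<nu> where "\<nu> = (\<lambda>A. \<Sum>r. \<Sum>l=1..m. c r l * emeasure (M r l) A)"
  have swap: "(\<Sum>i. \<Sum>r. h i r) = (\<Sum>r. \<Sum>i. h i r)" for h :: "nat \<Rightarrow> nat \<Rightarrow> ennreal"
    using nn_integral_suminf[of "\<lambda>r i. h i r" "count_space UNIV"]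
    by (simp add: nn_integral_count_space_nat)
  have ca: "countably_additive (sets borel) \<nu>"
  proof (rule countably_additiveI)
    fix B :: "nat \<Rightarrow> (real ^ 'a) set"
    assume B: "range B \<subseteq> sets borel" "disjoint_family B"
    have "(\<Sum>i. emeasure (M r l) (B i)) = emeasure (M r l) (\<Union>i. B i)" for r l
      using B by (intro suminf_emeasure) (auto simp: M_def)
    then have "(\<Sum>i. \<Sum>l=1..m. c r l * emeasure (M r l) (B i))
        = (\<Sum>l=1..m. c r l * emeasure (M r l) (\<Union>i. B i))" for r
      by (subst suminf_sum) (auto simp: summableI)
    then show "(\<Sum>i. \<nu> (B i)) = \<nu> (\<Union>i. B i)"
      unfolding \<nu>_def by (subst swap) simp
  qed
  have pos: "positive (sets borel) \<nu>"
    by (simp add: positive_def \<nu>_def)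
  have "emeasure (measure_of UNIV (sets borel) \<nu>) A = \<nu> A"
    using sets.sigma_algebra_axioms[of borel] ca pos assms
    by (intro emeasure_measure_of_sigma) auto
  then show ?thesis
    by (simp add: levy_measure_def \<nu>_def c_def M_def)
qed

text \<open>The minus sign in the exponent is intended.\<close>

definition compound_poisson_with_levy :: "(real ^ 'd \<Rightarrow> complex) \<Rightarrow> (real ^ 'd) measure \<Rightarrow> bool" where
  "compound_poisson_with_levy f N \<longleftrightarrow>
     finite_measure N \<and> sets N = sets borel \<and> emeasure N {0} = 0 \<and>
     (\<forall>t. f t = exp (\<integral>x. (exp (- (\<i> * complex_of_real (t \<bullet> x))) - 1) \<partial>N))"

end

theory Submission
  imports Defs
begin

text \<open>
  Put \<open>\<beta> l = \<alpha> l * exp (- (a l \<bullet> \<sigma>))\<close>, so that \<open>\<bar>\<beta> l\<bar> < 1\<close>. The normalized Euler product has the factors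
  \<open>(1 - \<beta> l) / (1 - \<beta> l * exp (- \<i> (a l \<bullet> t)))\<close>. If \<open>\<beta> l \<ge> 0\<close>, such a factor is the characteristic
  function of \<open>- n *\<^sub>R a l\<close> for a geometrically distributed \<open>n\<close>, and expanding its logarithm as a power
  series gives the Levy measure. The numbers \<open>a l \<bullet> t\<close> can be prescribed arbitrarily because the \<open>a l\<close>
  are independent, which isolates a single factor with negative \<open>\<beta> l\<close>.
\<close>

section \<open>Characteristic functions on Euclidean space: products and the geometric law\<close>

definition char_vec :: "'a::euclidean_space measure \<Rightarrow> 'a \<Rightarrow> complex" where
  "char_vec M t = (\<integral>x. iexp (t \<bullet> x) \<partial>M)"

lemma norm_char_vec_le_1:
  assumes "prob_space M"
  shows "norm (char_vec M t) \<le> 1"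
proof -
  interpret prob_space M by fact
  have "norm (char_vec M t) \<le> (\<integral>x. norm (iexp (t \<bullet> x)) \<partial>M)"
    unfolding char_vec_def by (rule integral_norm_bound)
  also have "\<dots> = 1"
    by (simp add: prob_space)
  finally show ?thesis .
qed

lemma is_char_fun_iff: "is_char_fun f \<longleftrightarrow>
    (\<exists>M. prob_space M \<and> sets M = sets borel \<and> f = char_vec M)"
  by (simp add: is_char_fun_def char_vec_def fun_eq_iff)

text \<open>Allows a witness to be a random vector on any probability space: the required measure is
  its law.\<close>

lemma is_char_fun_distr:
  fixes g :: "'a \<Rightarrow> real ^ 'd"
  assumes "prob_space M" and [measurable]: "g \<in> borel_measurable M"
    and "\<And>t. f t = (\<integral>x. iexp (t \<bullet> g x) \<partial>M)"
  shows "is_char_fun f"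
  unfolding is_char_fun_def
proof (intro exI[of _ "distr M borel g"] conjI allI)
  show "prob_space (distr M borel g)"
    using assms by (intro prob_space.prob_space_distr)
  show "f t = (\<integral>x. exp (\<i> * complex_of_real (t \<bullet> x)) \<partial>distr M borel g)" for t
    by (subst integral_distr) (auto simp: assms)
qed simp

lemma is_char_fun_1: "is_char_fun (\<lambda>_::real ^ 'd. 1)"
  by (rule is_char_fun_distr[of "return_pmf ()" "\<lambda>_. 0"])
     (auto simp: measure_pmf.prob_space_axioms)

text \<open>The product belongs to the sum of two independent random vectors, realized as
  \<open>x + y\<close> on the product space; Fubini factors the integral.\<close>

lemma is_char_fun_mult:
  fixes f g :: "real ^ 'd \<Rightarrow> complex"
  assumes "is_char_fun f" "is_char_fun g"
  shows "is_char_fun (\<lambda>t. f t * g t)"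
proof -
  obtain M N where M: "prob_space M" "sets M = sets borel" "f = char_vec M"
    and N: "prob_space N" "sets N = sets borel" "g = char_vec N"
    using assms unfolding is_char_fun_iff by blast
  interpret M: prob_space M by fact
  interpret N: prob_space N by fact
  interpret P: pair_prob_space M N ..
  note [measurable_cong] = M(2) N(2)
  show ?thesis
  proof (rule is_char_fun_distr)
    show "prob_space (M \<Otimes>\<^sub>M N)" by (rule P.prob_space_axioms)
    show "(\<lambda>(x, y). x + y) \<in> borel_measurable (M \<Otimes>\<^sub>M N)" by measurable
    fix t :: "real ^ 'd"
    have "integrable (M \<Otimes>\<^sub>M N) (\<lambda>(x, y). iexp (t \<bullet> (x + y)))"
      using P.integrable_iexp[of "\<lambda>(x, y). t \<bullet> (x + y)"] by (simp add: case_prod_unfold)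
    then have "(\<integral>p. iexp (t \<bullet> (case p of (x, y) \<Rightarrow> x + y)) \<partial>(M \<Otimes>\<^sub>M N)) =
        (\<integral>x. \<integral>y. iexp (t \<bullet> (x + y)) \<partial>N \<partial>M)"
      by (subst P.integral_fst'[symmetric]) (auto simp: case_prod_unfold)
    also have "\<dots> = f t * g t"
      by (simp add: M(3) N(3) char_vec_def inner_add_right ring_distribs exp_add)
    finally show "f t * g t = (\<integral>p. iexp (t \<bullet> (case p of (x, y) \<Rightarrow> x + y)) \<partial>(M \<Otimes>\<^sub>M N))" ..
  qed
qed

lemma is_char_fun_prod:
  assumes "finite I" "\<And>i. i \<in> I \<Longrightarrow> is_char_fun (f i)"
  shows "is_char_fun (\<lambda>t. \<Prod>i\<in>I. f i t)"
  using assms by (induction I rule: finite_induct) (auto intro: is_char_fun_1 is_char_fun_mult)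

text \<open>A geometric series in \<open>\<beta> * iexp (t \<bullet> a)\<close>: the quotient
  belongs to the random vector \<open>n *\<^sub>R a\<close>, where \<open>n\<close> takes each value
  from 0 on with probability \<open>(1 - \<beta>) * \<beta> ^ n\<close>.\<close>

lemma is_char_fun_geometric:
  fixes a :: "real ^ 'd"
  assumes "0 \<le> \<beta>" "\<beta> < 1"
  shows "is_char_fun (\<lambda>t. (1 - of_real \<beta>) / (1 - of_real \<beta> * iexp (t \<bullet> a)))"
proof (rule is_char_fun_distr)
  let ?p = "geometric_pmf (1 - \<beta>)"
  show "prob_space (measure_pmf ?p)"
    by (rule measure_pmf.prob_space_axioms)
  show "(\<lambda>n. real n *\<^sub>R a) \<in> borel_measurable (measure_pmf ?p)" by simp
  fix t :: "real ^ 'd"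
  define w where "w = of_real \<beta> * iexp (t \<bullet> a)"
  have nw: "norm w < 1"
    using assms by (simp add: w_def norm_mult)
  have pw: "pmf ?p n *\<^sub>R iexp (t \<bullet> (real n *\<^sub>R a)) = (1 - of_real \<beta>) * w ^ n" for n
  proof -
    have "iexp (t \<bullet> (real n *\<^sub>R a)) = iexp (t \<bullet> a) ^ n"
      using exp_of_nat_mult[of n "\<i> * of_real (t \<bullet> a)"] by (simp add: mult.left_commute)
    then show ?thesis
      using assms by (simp only: w_def power_mult_distrib) (simp add: scaleR_conv_of_real)
  qed
  \<comment> \<open>The law has density \<open>pmf ?p\<close> with respect to counting measure, so
    the expectation becomes a series.\<close>
  have "(\<integral>n. iexp (t \<bullet> (real n *\<^sub>R a)) \<partial>measure_pmf ?p) =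
      (\<integral>n. (1 - of_real \<beta>) * w ^ n \<partial>count_space UNIV)"
    unfolding measure_pmf_eq_density
    by (subst integral_density) (auto simp only: pw, auto)
  also have "\<dots> = (\<Sum>n. (1 - of_real \<beta>) * w ^ n)"
    using nw by (intro integral_count_space_nat)
      (auto simp: integrable_count_space_nat_iff norm_mult norm_power intro!: summable_mult)
  also have "\<dots> = (1 - of_real \<beta>) / (1 - w)"
    using nw sums_mult[OF geometric_sums[OF nw], of "1 - of_real \<beta>"] by (simp add: sums_iff)
  finally show "(1 - of_real \<beta>) / (1 - of_real \<beta> * iexp (t \<bullet> a)) =
      (\<integral>n. iexp (t \<bullet> (real n *\<^sub>R a)) \<partial>measure_pmf ?p)"
    by (simp add: w_def)
qed

section \<open>Prescribed inner products and the factors of the Euler product\<close>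

text \<open>Values on an independent family extend to a linear functional \<open>g\<close>, which is
  represented by the vector \<open>adjoint g 1\<close>.\<close>

lemma obtain_inner_vector:
  fixes a :: "'i \<Rightarrow> 'a::euclidean_space"
  assumes "inj_on a I" "independent (a ` I)"
  obtains t where "\<And>i. i \<in> I \<Longrightarrow> a i \<bullet> t = \<theta> i"
proof -
  obtain g :: "'a \<Rightarrow> real" where g: "linear g" "\<forall>x\<in>a ` I. g x = \<theta> (the_inv_into I a x)"
    using linear_independent_extend[OF assms(2), of "\<lambda>x. \<theta> (the_inv_into I a x)"] by metis
  have "a i \<bullet> adjoint g 1 = \<theta> i" if "i \<in> I" for i
    using that g assms(1) by (simp add: adjoint_works the_inv_into_f_f)
  then show thesis by (rule that)
qed

lemma f_norm_eq_prod:
  "f_norm m \<alpha> a \<sigma> t =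
    (\<Prod>l=1..m. (1 - of_real (\<alpha> l * exp (- (a l \<bullet> \<sigma>)))) /
      (1 - of_real (\<alpha> l * exp (- (a l \<bullet> \<sigma>))) * iexp (t \<bullet> - a l)))"
proof -
  have "exp (- cinner b (complex_vec \<sigma> u)) = of_real (exp (- (b \<bullet> \<sigma>))) * iexp (u \<bullet> - b)" for b u
  proof -
    have "- cinner b (complex_vec \<sigma> u) = of_real (- (b \<bullet> \<sigma>)) + \<i> * of_real (u \<bullet> - b)"
      by (simp add: cinner_def complex_vec_def complex_eq_iff inner_commute)
    then show ?thesis by (simp only: exp_add exp_of_real)
  qed
  \<comment> \<open>With \<open>inverse 0 = 0\<close> both sides are 0 when a factor vanishes, so
    the identity is unconditional.\<close>
  then show ?thesis
    by (simp add: f_norm_def Z_fE_def prod_dividef[symmetric] field_simps)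
qed

section \<open>The logarithm series and the Levy measure\<close>

lemma minus_Ln_series:
  assumes "norm (z::complex) < 1"
  shows "(\<lambda>n. z ^ Suc n / of_nat (Suc n)) sums (- Ln (1 - z))"
proof -
  have "(\<lambda>n. - (z ^ n / of_nat n)) sums Ln (1 - z)"
    using Ln_series'[of "- z"] assms by simp
  then have "(\<lambda>n. z ^ n / of_nat n) sums (- Ln (1 - z))"
    using sums_minus by fastforce
  \<comment> \<open>The dropped term at index 0 is \<open>z ^ 0 / 0\<close>, which is 0 by
    convention, so the shift leaves the sum unchanged.\<close>
  then show ?thesis by (subst sums_Suc_iff) simp
qed

text \<open>Turns integrals against the Levy measure into sums over index pairs
  \<open>(l, r)\<close>: its atoms are the images of weighted points of a counting measure.\<close>

lemma levy_measure_eq_distr: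
  "levy_measure m \<alpha> a \<sigma> = distr
     (density (count_space ({1..m} \<times> UNIV)) (\<lambda>(l, r).
        ennreal (1 / real (Suc r) * \<alpha> l ^ Suc r * exp (- (real (Suc r) * (a l \<bullet> \<sigma>))))))
     borel (\<lambda>(l, r). real (Suc r) *\<^sub>R a l)"
  (is "_ = distr (density ?C (\<lambda>(l, r). ?c l r)) borel ?g")
proof (rule measure_eqI)
  fix A assume "A \<in> sets (levy_measure m \<alpha> a \<sigma>)"
  then have A [measurable]: "A \<in> sets borel" by simp
  have "emeasure (distr (density ?C (\<lambda>(l, r). ?c l r)) borel ?g) A =
      (\<integral>\<^sup>+x. (case x of (l, r) \<Rightarrow> ?c l r) * indicator (?g -` A \<inter> {1..m} \<times> UNIV) x \<partial>?C)"
    by (simp add: emeasure_distr emeasure_density)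
  also have "\<dots> = (\<integral>\<^sup>+x. (case x of (l, r) \<Rightarrow> ?c l r * indicator A (?g (l, r))) \<partial>?C)"
    by (intro nn_integral_cong) (auto simp: indicator_def)
  \<comment> \<open>Counting measure on the pairs is a product measure, which makes Tonelli
    applicable.\<close>
  also have "\<dots> = (\<integral>\<^sup>+x. (case x of (l, r) \<Rightarrow> ?c l r * indicator A (?g (l, r)))
      \<partial>(count_space {1..m} \<Otimes>\<^sub>M count_space UNIV))"
    by (simp only: pair_measure_countable[OF countable_finite countableI_type]
        finite_atLeastAtMost)
  also have "\<dots> = (\<integral>\<^sup>+l. \<integral>\<^sup>+r. ?c l r * indicator A (?g (l, r)) \<partial>count_space UNIV
      \<partial>count_space {1..m})"
    by (subst sigma_finite_measure.nn_integral_fst[symmetric])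
       (auto intro: sigma_finite_measure_count_space_countable simp: pair_measure_countable)
  also have "\<dots> = (\<Sum>l=1..m. \<Sum>r. ?c l r * indicator A (?g (l, r)))"
    by (simp add: nn_integral_count_space_finite nn_integral_count_space_nat)
  also have "\<dots> = (\<Sum>r. \<Sum>l=1..m. ?c l r * indicator A (?g (l, r)))"
    by (rule suminf_sum[symmetric]) (rule summableI)
  also have "\<dots> = emeasure (levy_measure m \<alpha> a \<sigma>) A"
    by (simp add: emeasure_levy_measure)
  finally show "emeasure (levy_measure m \<alpha> a \<sigma>) A =
      emeasure (distr (density ?C (\<lambda>(l, r). ?c l r)) borel ?g) A" ..
qed simp

text \<open>In this form the weights are the terms of the series of
  \<open>- Ln (1 - \<beta>)\<close> with \<open>\<beta> = \<alpha> * exp (- s)\<close>.\<close>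

lemma levy_weight_eq:
  fixes \<alpha> s :: real
  shows "1 / real (Suc r) * \<alpha> ^ Suc r * exp (- (real (Suc r) * s)) =
    (\<alpha> * exp (- s)) ^ Suc r / real (Suc r)"
  using exp_of_nat_mult[of "Suc r" "- s"]
  by (simp add: power_mult_distrib del: of_nat_Suc power_Suc)

text \<open>For fixed \<open>l\<close>, the atoms contribute the sum of
  \<open>\<beta> ^ r * (z ^ r - 1) / r\<close> over \<open>r\<close> from 1 on to the exponent. This
  is \<open>Ln (1 - \<beta>) - Ln (1 - \<beta> * z)\<close>, a logarithm of the \<open>l\<close>-th
  factor.\<close>

lemma compound_poisson_f_norm:
  assumes \<alpha>: "\<And>l. l \<in> {1..m} \<Longrightarrow> 0 \<le> \<alpha> l \<and> \<alpha> l * exp (- (a l \<bullet> \<sigma>)) < 1"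
    and a: "\<And>l. l \<in> {1..m} \<Longrightarrow> a l \<noteq> 0"
  shows "compound_poisson_with_levy (f_norm m \<alpha> a \<sigma>) (levy_measure m \<alpha> a \<sigma>)"
proof -
  define \<beta> where "\<beta> l = \<alpha> l * exp (- (a l \<bullet> \<sigma>))" for l
  have \<beta>: "0 \<le> \<beta> l" "\<beta> l < 1" if "l \<in> {1..m}" for l
    using \<alpha>[OF that] by (auto simp: \<beta>_def)
  let ?C = "count_space ({1..m} \<times> (UNIV :: nat set))"
  define c where "c = (\<lambda>(l, r). \<beta> l ^ Suc r / real (Suc r))"
  define g where "g = (\<lambda>(l, r). real (Suc r) *\<^sub>R a l)"
  have c_nonneg: "0 \<le> c x" if "x \<in> {1..m} \<times> UNIV" for x
    using that \<beta>(1) by (auto simp: c_def)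
  let ?N = "levy_measure m \<alpha> a \<sigma>"
  have N: "?N = distr (density ?C (\<lambda>x. ennreal (c x))) borel g"
    by (simp only: levy_measure_eq_distr levy_weight_eq c_def g_def \<beta>_def case_prod_unfold)
  have summable_\<beta>: "summable (\<lambda>r. \<beta> l ^ Suc r / real (Suc r))" if "l \<in> {1..m}" for l
  proof -
    have "(\<lambda>r. complex_of_real (\<beta> l ^ Suc r / real (Suc r))) sums (- Ln (1 - of_real (\<beta> l)))"
      using minus_Ln_series[of "of_real (\<beta> l)"] \<beta>[OF that] by simp
    then show ?thesis
      by (metis sums_summable summable_of_real_iff)
  qed
  \<comment> \<open>There are finitely many rows \<open>l\<close>, and the weights are nonnegative,
    so summability of each row suffices.\<close>
  have c_summable: "Infinite_Set_Sum.abs_summable_on c ({1..m} \<times> UNIV)"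
    using summable_\<beta> \<beta>(1)
    by (subst abs_summable_on_Sigma_iff) (auto simp: c_def abs_summable_on_nat_iff')
  have fin: "finite_measure ?N"
  proof
    have "emeasure ?N (space ?N) = (\<integral>\<^sup>+x. ennreal (c x) \<partial>?C)"
      unfolding N by (simp add: emeasure_distr emeasure_density del: One_nat_def
          cong: nn_integral_cong_simp)
    also have "\<dots> = ennreal (infsetsum c ({1..m} \<times> UNIV))"
      unfolding infsetsum_def using c_summable c_nonneg
      by (intro nn_integral_eq_integral) (auto simp: Infinite_Set_Sum.abs_summable_on_def AE_count_space)
    finally show "emeasure ?N (space ?N) \<noteq> \<infinity>" by simp
  qed
  \<comment> \<open>Every atom is a positive multiple of a nonzero \<open>a l\<close>, so none lies
    at the origin.\<close>
  have "g -` {0} \<inter> {1..m} \<times> UNIV = {}"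
    using a by (auto simp: g_def simp del: of_nat_Suc)
  then have zero: "emeasure ?N {0} = 0"
    by (simp add: N emeasure_distr)
  have "f_norm m \<alpha> a \<sigma> t = exp (\<integral>x. (exp (- (\<i> * complex_of_real (t \<bullet> x))) - 1) \<partial>?N)" for t
  proof -
    define z where "z l = iexp (t \<bullet> - a l)" for l
    define h where "h x = c x *\<^sub>R (exp (- (\<i> * complex_of_real (t \<bullet> g x))) - 1)" for x
    \<comment> \<open>Splits each term into terms of two logarithm series, one at
      \<open>\<beta> l * z l\<close> and one at \<open>\<beta> l\<close>.\<close>
    have h: "h (l, r) = (of_real (\<beta> l) * z l) ^ Suc r / of_nat (Suc r)
        - of_real (\<beta> l) ^ Suc r / of_nat (Suc r)" for l r
    proof -
      have "exp (- (\<i> * complex_of_real (t \<bullet> g (l, r)))) = z l ^ Suc r"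
        unfolding z_def g_def using exp_of_nat_mult[of "Suc r" "\<i> * of_real (t \<bullet> - a l)"]
        by (simp add: algebra_simps)
      then show ?thesis
        by (simp only: h_def c_def prod.case)
           (simp add: scaleR_conv_of_real power_mult_distrib right_diff_distrib diff_divide_distrib
             del: of_nat_Suc power_Suc)
    qed
    \<comment> \<open>Two points of the unit circle are at distance at most 2, so the weights
      dominate \<open>h\<close>.\<close>
    have h_le: "norm (h x) \<le> 2 * c x" if "x \<in> {1..m} \<times> UNIV" for x
    proof -
      have "norm (exp (- (\<i> * complex_of_real (t \<bullet> g x))) - 1) \<le> 2"
        by (rule order.trans[OF norm_triangle_ineq4]) simp
      then show ?thesis
        using c_nonneg[OF that] by (simp add: h_def mult.commute[of 2] mult_left_mono)
    qed
    have h_summable: "Infinite_Set_Sum.abs_summable_on h ({1..m} \<times> UNIV)"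
      by (rule Infinite_Set_Sum.abs_summable_on_comparison_test'[OF _ h_le])
         (rule Infinite_Set_Sum.abs_summable_on_cmult_right[OF c_summable])
    have h_sums: "(\<lambda>r. h (l, r)) sums (Ln (1 - of_real (\<beta> l)) - Ln (1 - of_real (\<beta> l) * z l))"
      if "l \<in> {1..m}" for l
    proof -
      have "norm (of_real (\<beta> l) * z l) < 1" "norm (complex_of_real (\<beta> l)) < 1"
        using \<beta>[OF that] by (auto simp: norm_mult z_def)
      from sums_diff[OF minus_Ln_series[OF this(1)] minus_Ln_series[OF this(2)]]
      show ?thesis by (simp only: h) simp
    qed
    have "(\<integral>x. (exp (- (\<i> * complex_of_real (t \<bullet> x))) - 1) \<partial>?N) = infsetsum h ({1..m} \<times> UNIV)"
      unfolding N infsetsum_def h_def using c_nonneg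
      by (subst integral_distr) (auto simp: AE_count_space intro!: integral_density)
    also have "\<dots> = (\<Sum>l=1..m. infsetsum (\<lambda>r. h (l, r)) UNIV)"
      by (subst infsetsum_Sigma) (simp_all add: h_summable del: One_nat_def)
    also have "\<dots> = (\<Sum>l=1..m. Ln (1 - of_real (\<beta> l)) - Ln (1 - of_real (\<beta> l) * z l))"
    proof (rule sum.cong)
      fix l assume l: "l \<in> {1..m}"
      have "Infinite_Set_Sum.abs_summable_on (\<lambda>r. h (l, r)) UNIV"
        using h_summable l by (subst (asm) abs_summable_on_Sigma_iff) auto
      then show "infsetsum (\<lambda>r. h (l, r)) UNIV =
          Ln (1 - of_real (\<beta> l)) - Ln (1 - of_real (\<beta> l) * z l)"
        using h_sums[OF l] by (simp add: infsetsum_nat' sums_iff)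
    qed simp
    \<comment> \<open>The exponential cancels each \<open>Ln\<close> whatever its branch, because
      the arguments are nonzero.\<close>
    also have "exp \<dots> = (\<Prod>l=1..m. (1 - of_real (\<beta> l)) / (1 - of_real (\<beta> l) * z l))"
      unfolding exp_sum[OF finite_atLeastAtMost]
    proof (rule prod.cong)
      fix l assume l: "l \<in> {1..m}"
      have "norm (of_real (\<beta> l) * z l) < 1" "norm (complex_of_real (\<beta> l)) < 1"
        using \<beta>[OF l] by (auto simp: norm_mult z_def)
      then have "1 - of_real (\<beta> l) * z l \<noteq> 0" "1 - complex_of_real (\<beta> l) \<noteq> 0"
        by auto
      then show "exp (Ln (1 - of_real (\<beta> l)) - Ln (1 - of_real (\<beta> l) * z l)) =
          (1 - of_real (\<beta> l)) / (1 - of_real (\<beta> l) * z l)"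
        by (simp add: exp_diff)
    qed simp
    finally show ?thesis
      by (simp add: f_norm_eq_prod \<beta>_def z_def)
  qed
  then show ?thesis
    using fin zero by (simp add: compound_poisson_with_levy_def)
qed

section \<open>Necessity of nonnegative coefficients\<close>

text \<open>
  If some \<open>\<beta> = \<alpha> l * exp (- (a l \<bullet> \<sigma>))\<close> is negative, independence provides a \<open>t\<close> at which all other
  factors are \<open>1\<close> and the \<open>l\<close>-th is \<open>(1 - \<beta>) / (1 + \<beta>) > 1\<close>, too large for a characteristic function.
\<close>

lemma is_char_fun_f_norm_imp_nonneg:
  assumes f: "is_char_fun (f_norm m \<alpha> a \<sigma>)" and l: "l \<in> {1..m}"
    and \<beta>_abs: "\<And>j. j \<in> {1..m} \<Longrightarrow> \<bar>\<alpha> j * exp (- (a j \<bullet> \<sigma>))\<bar> < 1"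
    and indep: "inj_on a {1..m}" "independent (a ` {1..m})"
  shows "0 \<le> \<alpha> l"
proof (rule ccontr)
  assume "\<not> 0 \<le> \<alpha> l"
  define \<beta> where "\<beta> j = \<alpha> j * exp (- (a j \<bullet> \<sigma>))" for j
  have \<beta>: "- 1 < \<beta> l" "\<beta> l < 0"
    using \<beta>_abs[OF l] \<open>\<not> 0 \<le> \<alpha> l\<close> by (auto simp: \<beta>_def mult_neg_pos)
  \<comment> \<open>The angle \<open>pi\<close> makes the exponential in factor \<open>l\<close>
    equal to -1, turning its denominator into \<open>1 + \<beta> l\<close>; the angle 0 makes
    numerator and denominator agree in all other factors.\<close>
  obtain t where t: "\<And>j. j \<in> {1..m} \<Longrightarrow> a j \<bullet> t = (if j = l then pi else 0)"
    using obtain_inner_vector[OF indep, of "\<lambda>j. if j = l then pi else 0"] by blast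
  have "f_norm m \<alpha> a \<sigma> t = (\<Prod>j=1..m. if j = l then of_real ((1 - \<beta> l) / (1 + \<beta> l)) else 1)"
    unfolding f_norm_eq_prod
  proof (rule prod.cong)
    fix j assume j: "j \<in> {1..m}"
    \<comment> \<open>Ensures that the quotient \<open>(1 - \<beta> j) / (1 - \<beta> j)\<close> is
      really 1 rather than the default \<open>0 / 0 = 0\<close>.\<close>
    have "complex_of_real (\<beta> j) \<noteq> 1"
      using \<beta>_abs[OF j] unfolding \<beta>_def[symmetric] by auto
    then show "(1 - of_real (\<alpha> j * exp (- (a j \<bullet> \<sigma>)))) /
        (1 - of_real (\<alpha> j * exp (- (a j \<bullet> \<sigma>))) * iexp (t \<bullet> - a j)) =
        (if j = l then complex_of_real ((1 - \<beta> l) / (1 + \<beta> l)) else 1)"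
      using t[OF j] unfolding \<beta>_def[symmetric] by (auto simp: inner_commute[of t] exp_minus)
  qed simp
  also have "\<dots> = of_real ((1 - \<beta> l) / (1 + \<beta> l))"
    using l by (subst prod.delta) auto
  finally have "norm (f_norm m \<alpha> a \<sigma> t) = (1 - \<beta> l) / (1 + \<beta> l)"
    using \<beta> by (simp only: norm_of_real) simp
  moreover have "1 < (1 - \<beta> l) / (1 + \<beta> l)"
    using \<beta> by (simp add: field_simps)
  moreover have "norm (f_norm m \<alpha> a \<sigma> t) \<le> 1"
    using f by (auto simp: is_char_fun_iff norm_char_vec_le_1)
  ultimately show False by linarith
qed

theorem theorem4p3:
  fixes X :: "('v, 'e) pre_digraph" and arev :: "'e \<Rightarrow> 'e"
    and X0 :: "('w, 'f) pre_digraph" and arev0 :: "'f \<Rightarrow> 'f"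
    and pV :: "'v \<Rightarrow> 'w" and pE :: "'e \<Rightarrow> 'f"
    and actV :: "int ^ 'd \<Rightarrow> 'v \<Rightarrow> 'v" and actE :: "int ^ 'd \<Rightarrow> 'e \<Rightarrow> 'e"
    and \<iota> :: "real ^ 'd \<Rightarrow> real ^ 'd"
    and \<Phi> :: "'v \<Rightarrow> real ^ 'd" and x_base :: 'v
    and S :: "(int ^ 'd) set"
    and m :: nat and \<alpha> :: "nat \<Rightarrow> real" and a :: "nat \<Rightarrow> real ^ 'd" and \<sigma> :: "real ^ 'd"
  assumes "crystal_lattice X arev X0 arev0 pV pE actV actE"
    and "card (verts X0) = 1"
    and "linear \<iota>" and "bij \<iota>"
    and "periodic_realization \<iota> X actV \<Phi>" and "nondegenerate X \<Phi>"
    and "x_base \<in> verts X" and "\<Phi> x_base = 0"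
    and "card S = CARD('d)" and "group_closure S = UNIV"
    and "m \<ge> 1"
    and "\<forall>l\<in>{1..m}. -1 \<le> \<alpha> l \<and> \<alpha> l \<le> 1"
    and "\<forall>l\<in>{1..m}. a l \<in> jump_set \<iota> S"
    and "inj_on a {1..m}" and "independent (a ` {1..m})"
    and "Min ((\<lambda>l. a l \<bullet> \<sigma>) ` {1..m}) > 0"
  shows "(is_char_fun (f_norm m \<alpha> a \<sigma>) \<longleftrightarrow> (\<forall>l\<in>{1..m}. \<alpha> l \<ge> 0))
    \<and> ((\<forall>l\<in>{1..m}. \<alpha> l \<ge> 0) \<longrightarrow>
        compound_poisson_with_levy (f_norm m \<alpha> a \<sigma>) (levy_measure m \<alpha> a \<sigma>))"
proof -
  \<comment> \<open>As \<alpha> may have modulus 1, strictness comes from the exponential, whose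
    exponent is negative by the condition on \<sigma>.\<close>
  have \<beta>: "\<bar>\<alpha> l * exp (- (a l \<bullet> \<sigma>))\<bar> < 1" if "l \<in> {1..m}" for l
  proof -
    have "0 < a l \<bullet> \<sigma>"
      using assms(16) that by (subst (asm) Min_gr_iff) auto
    moreover have "\<bar>\<alpha> l\<bar> \<le> 1"
      using assms(12) that by (auto simp: abs_le_iff)
    ultimately have "\<bar>\<alpha> l\<bar> * exp (- (a l \<bullet> \<sigma>)) \<le> 1 * exp (- (a l \<bullet> \<sigma>))"
      "exp (- (a l \<bullet> \<sigma>)) < 1"
      by (auto intro: mult_right_mono)
    then show ?thesis by (simp only: abs_mult abs_exp_cancel mult_1_left)
  qed
  \<comment> \<open>An independent set does not contain 0; this keeps the Levy measure off the
    origin.\<close>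
  have nonzero: "a l \<noteq> 0" if "l \<in> {1..m}" for l
    using assms(15) that dependent_zero[of "a ` {1..m}"] by force
  have "is_char_fun (f_norm m \<alpha> a \<sigma>)" if "\<forall>l\<in>{1..m}. \<alpha> l \<ge> 0"
    unfolding f_norm_eq_prod[abs_def]
    using that \<beta> by (intro is_char_fun_prod is_char_fun_geometric) force+
  moreover have "\<alpha> l \<ge> 0" if "is_char_fun (f_norm m \<alpha> a \<sigma>)" "l \<in> {1..m}" for l
    using is_char_fun_f_norm_imp_nonneg[OF that \<beta> assms(14,15)] .
  moreover have "compound_poisson_with_levy (f_norm m \<alpha> a \<sigma>) (levy_measure m \<alpha> a \<sigma>)"
    if "\<forall>l\<in>{1..m}. \<alpha> l \<ge> 0"
    using that \<beta> nonzero by (intro compound_poisson_f_norm) force+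
  ultimately show ?thesis by blast
qed

end
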